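(* Let $w=[a_1,\dots,a_n]\in W(B_n)$. Then $w\in B_{n,4}$ if and only if no pair of indices $i<j$ satisfies $a_i>a_j$ and $a_i,a_j<0$.
   Context: Let $n\geqslant 2$. $W(B_n)$ is the group (under composition) of all permutations $w$ of $\{\pm1,\dots,\pm n\}$ with $w(-a)=-w(a)$ for all $a$; one writes $w=[a_1,\dots,a_n]$ if $w(i)=a_i$ for $1\leqslant i\leqslant n$. It is a Coxeter group of type $B_n$ with simple generators $s_0=[-1,2,\dots,n]$ and $s_i=[1,\dots,i-1,i+1,i,i+2,\dots,n]$ for $1\leqslant i\leqslant n-1$ (so $m_{01}=4$, $m_{i,i+1}=3$ for $1\leqslant i\leqslant n-2$, and all other pairs of distinct generators commute). $B_{n,4}$ is the set of elements $w\in W(B_n)$ for which no reduced expression (in the generators $s_0,\dots,s_{n-1}$) contains the substring $s_0s_1s_0s_1$ or $s_1s_0s_1s_0$ of consecutive letters. *)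

theory Defs
  imports "HOL-Combinatorics.Permutations" "HOL-Library.Sublist"
begin

definition pm_set :: "nat \<Rightarrow> int set" where
  "pm_set n = {k. k \<noteq> 0 \<and> \<bar>k\<bar> \<le> int n}"

text \<open>Elements of $W(B_n)$ are functions on all integers, extended by the identity outside
  $\{\pm 1,\dots,\pm n\}$; the group operation is function composition.\<close>

definition WB :: "nat \<Rightarrow> (int \<Rightarrow> int) set" where
  "WB n = {w. w permutes pm_set n \<and> (\<forall>a\<in>pm_set n. w (- a) = - w a)}"

text \<open>Because of the extension by the identity, the generator $s_i$ does not depend on $n$.\<close>

definition sgen :: "nat \<Rightarrow> int \<Rightarrow> int" where
  "sgen i = (if i = 0 then transpose (- 1) 1
             else transpose (int i) (int i + 1) \<circ> transpose (- int i) (- (int i + 1)))"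

lemma sgen_0_window: "sgen 0 1 = - 1" "k \<ge> 2 \<Longrightarrow> sgen 0 (int k) = int k"
  by (auto simp: sgen_def transpose_def)

lemma sgen_window:
  assumes "i \<ge> 1"
  shows "sgen i (int i) = int (i + 1)"
    and "sgen i (int (i + 1)) = int i"
    and "k \<ge> 1 \<Longrightarrow> k \<noteq> i \<Longrightarrow> k \<noteq> i + 1 \<Longrightarrow> sgen i (int k) = int k"
  using assms by (auto simp: sgen_def transpose_def)

lemma sgen_in_WB:
  assumes "i < n"
  shows "sgen i \<in> WB n"
proof (cases "i = 0")
  case True
  then show ?thesis
    using assms by (auto simp: WB_def sgen_def pm_set_def transpose_def intro!: permutes_swap_id)
next
  case False
  then have "sgen i permutes pm_set n"
    using assms unfolding sgen_def
    by (auto simp: pm_set_def intro!: permutes_compose permutes_swap_id)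
  then show ?thesis
    using assms False by (auto simp: WB_def sgen_def pm_set_def transpose_def)
qed

text \<open>A word $s_{i_1} \cdots s_{i_k}$ in the generators is represented by the list
  $[i_1,\dots,i_k]$ of its indices.\<close>

definition word_prod :: "nat list \<Rightarrow> int \<Rightarrow> int" where
  "word_prod is = foldr (\<circ>) (map sgen is) id"

definition expression_of :: "nat \<Rightarrow> (int \<Rightarrow> int) \<Rightarrow> nat list \<Rightarrow> bool" where
  "expression_of n w is \<longleftrightarrow> set is \<subseteq> {..<n} \<and> word_prod is = w"

definition reduced_expression_of :: "nat \<Rightarrow> (int \<Rightarrow> int) \<Rightarrow> nat list \<Rightarrow> bool" where
  "reduced_expression_of n w is \<longleftrightarrow>
     expression_of n w is \<and> (\<forall>js. expression_of n w js \<longrightarrow> length is \<le> length js)"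

text \<open>The predicate \<^const>\<open>sublist\<close> refers to contiguous sublists.\<close>

definition B4 :: "nat \<Rightarrow> (int \<Rightarrow> int) set" where
  "B4 n = {w \<in> WB n. \<forall>is. reduced_expression_of n w is \<longrightarrow>
             \<not> sublist [0, 1, 0, 1] is \<and> \<not> sublist [1, 0, 1, 0] is}"

end

theory Submission
  imports Defs
begin

text \<open>Call a pair of positions \<open>0 < x < y \<le> n\<close> with \<open>w y < w x < 0\<close> a negative inversion of
  \<open>w\<close>. The theorem says that \<open>w\<close> has a negative inversion if and only if some reduced expression
  of \<open>w\<close> contains \<open>s\<^sub>0 s\<^sub>1 s\<^sub>0 s\<^sub>1\<close> or \<open>s\<^sub>1 s\<^sub>0 s\<^sub>1 s\<^sub>0\<close>. Both of these words express the element that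
  negates the first two entries of the window.

  The generator \<open>s\<^sub>k\<close> acts on the right by exchanging two neighbouring positions of
  \<open>\<pm>1, \<dots>, \<pm>n\<close> (and the two opposite ones); \<open>w\<close> has a descent at \<open>k\<close> if its values at these
  positions are in the wrong order. The exchange property (\<open>exchange\<close>) gives the link with
  reduced words: a letter of a reduced word never follows a prefix that has a descent there
  (\<open>reduced_ascent\<close>), and a reduced word of \<open>w \<circ> s\<^sub>k\<close> followed by \<open>k\<close> is a reduced word of \<open>w\<close> if
  \<open>w\<close> has a descent at \<open>k\<close> (\<open>reduced_snoc\<close>).

  If \<open>s\<^sub>0 s\<^sub>1 s\<^sub>0 s\<^sub>1\<close> occurs in a reduced word after a prefix \<open>u\<close>, then these four letters are ascents,
  which forces \<open>0 < u 1 < u 2\<close>. Right after them the window starts with \<open>-u 1, -u 2\<close>, a negative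
  inversion. The later letters are ascents as well, and an ascent cannot destroy a negative
  inversion: it exchanges only neighbours that are in increasing order and negates only a
  positive first entry.

  Conversely, let \<open>w\<close> have a negative inversion. If one exists that is not at the positions
  \<open>1, 2\<close>, then \<open>w\<close> has a descent whose removal keeps a negative inversion (it pushes a smaller
  entry to the left, or makes a negative first entry positive), and induction applies. If
  \<open>w 2 < w 1 < 0\<close>, then four successive descents at \<open>1, 0, 1, 0\<close> can be removed, so that some
  reduced word of \<open>w\<close> ends with \<open>s\<^sub>0 s\<^sub>1 s\<^sub>0 s\<^sub>1\<close>.\<close>

section \<open>Signed permutations\<close>

lemma WB_odd:
  assumes "w \<in> WB n"
  shows "w (- x) = - w x"
proof (cases "x \<in> pm_set n")
  case True
  then show ?thesis using assms by (auto simp: WB_def)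
next
  case False
  then have "- x \<notin> pm_set n" by (auto simp: pm_set_def)
  then show ?thesis using False assms by (auto simp: WB_def permutes_not_in)
qed

lemma WB_inj: "w \<in> WB n \<Longrightarrow> inj w"
  by (auto simp: WB_def permutes_inj)

lemma WB_eq_iff: "w \<in> WB n \<Longrightarrow> w x = w y \<longleftrightarrow> x = y"
  by (auto dest: WB_inj simp: inj_eq)

lemma WB_zero: "w \<in> WB n \<Longrightarrow> w 0 = 0"
  by (auto simp: WB_def pm_set_def permutes_not_in)

lemma WB_eq_0_iff: "w \<in> WB n \<Longrightarrow> w x = 0 \<longleftrightarrow> x = 0"
  by (metis WB_eq_iff WB_zero)

lemma WB_abs_le: 
  assumes "w \<in> WB n" "\<bar>x\<bar> \<le> int n"
  shows "\<bar>w x\<bar> \<le> int n"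
proof (cases "x = 0")
  case False
  then have "w x \<in> pm_set n"
    using assms permutes_in_image[of w "pm_set n" x] by (auto simp: WB_def pm_set_def)
  then show ?thesis by (auto simp: pm_set_def)
qed (use assms in \<open>simp add: WB_zero\<close>)

lemma WB_comp:
  assumes "v \<in> WB n" "w \<in> WB n"
  shows "v \<circ> w \<in> WB n"
proof -
  have "v \<circ> w permutes pm_set n"
    using assms by (auto simp: WB_def intro: permutes_compose)
  then show ?thesis using assms by (simp add: WB_def WB_odd[OF assms(1)] WB_odd[OF assms(2)])
qed

lemma finite_pm_set: "finite (pm_set n)"
  by (rule finite_subset[of _ "{- int n..int n}"]) (auto simp: pm_set_def)

lemma sgen_odd: "sgen k (- x) = - sgen k x"
  using WB_odd[OF sgen_in_WB[of k "Suc k"]] by simp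

lemma inj_sgen: "inj (sgen k)"
  using WB_inj[OF sgen_in_WB[of k "Suc k"]] by simp

lemma sgen_eq_0_iff: "sgen k x = 0 \<longleftrightarrow> x = 0"
  using WB_eq_0_iff[OF sgen_in_WB[of k "Suc k"]] by simp

lemma sgen_sgen [simp]: "sgen k (sgen k x) = x"
  by (auto simp: sgen_def transpose_def)

lemma comp_sgen_sgen [simp]: "w \<circ> sgen k \<circ> sgen k = w"
  by (auto simp: fun_eq_iff)

lemma word_prod_Nil: "word_prod [] = id"
  by (simp add: word_prod_def)

lemma word_prod_append: "word_prod (us @ vs) = word_prod us \<circ> word_prod vs"
  by (induction us) (auto simp: word_prod_def)

lemma word_prod_snoc: "word_prod (us @ [k]) = word_prod us \<circ> sgen k"
  by (simp add: word_prod_append) (simp add: word_prod_def)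

lemma word_prod_in_WB:
  assumes "set us \<subseteq> {..<n}"
  shows "word_prod us \<in> WB n"
  using assms
proof (induction us rule: rev_induct)
  case Nil
  then show ?case using permutes_id[of "pm_set n"] by (simp add: word_prod_Nil WB_def id_def)
next
  case (snoc k us)
  then show ?case unfolding word_prod_snoc by (intro WB_comp sgen_in_WB) auto
qed

lemma braid_relation: "word_prod [1, 0, 1, 0] = word_prod [0, 1, 0, 1]"
  by (auto simp: word_prod_def sgen_def transpose_def fun_eq_iff)

section \<open>Descents and the exchange property\<close>

text \<open>The generator \<open>s\<^sub>k\<close> exchanges the neighbouring positions \<open>lower_pos k\<close> and \<open>k + 1\<close>. The
  value \<open>-1\<close> for \<open>k = 0\<close> takes into account that \<open>0\<close> is not a position; it makes a negative
  first entry a descent like any other.\<close>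

definition lower_pos :: "nat \<Rightarrow> int" where
  "lower_pos k = (if k = 0 then - 1 else int k)"

definition descent :: "(int \<Rightarrow> int) \<Rightarrow> nat \<Rightarrow> bool" where
  "descent w k \<longleftrightarrow> w (int k + 1) < w (lower_pos k)"

text \<open>These are the reflections of the group, written in terms of pairs of positions instead of
  roots.\<close>

definition reflection :: "int \<Rightarrow> int \<Rightarrow> int \<Rightarrow> int" where
  "reflection x y =
     (if y = - x then transpose x y else transpose x y \<circ> transpose (- x) (- y))"

lemma sgen_reflection: "sgen k = reflection (lower_pos k) (int k + 1)"
  by (auto simp: sgen_def reflection_def lower_pos_def)

lemma comp_transpose: "inj g \<Longrightarrow> g \<circ> transpose p q = transpose (g p) (g q) \<circ> g"
  by (auto simp: fun_eq_iff transpose_def inj_eq)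

lemma reflection_uminus:
  assumes "x \<noteq> 0" "y \<noteq> 0"
  shows "reflection (- y) (- x) = reflection x y"
proof (cases "y = - x")
  case False
  then have "transpose (- y) (- x) \<circ> transpose y x = transpose y x \<circ> transpose (- y) (- x)"
    using assms comp_transpose[of "transpose (- y) (- x)" y x] by simp
  then show ?thesis using False by (simp add: reflection_def transpose_commute)
qed (simp add: reflection_def)

lemma reflection_conj:
  assumes "inj g" "\<And>x. g (- x) = - g x"
  shows "g \<circ> reflection x y = reflection (g x) (g y) \<circ> g"
proof -
  have *: "y = - x \<longleftrightarrow> g y = - g x" using assms by (metis injD)
  note ** = comp_transpose[OF assms(1)]
  show ?thesis
  proof (cases "y = - x")
    case True
    then show ?thesis using * ** by (simp add: reflection_def)
  next
    case False
    then have "g \<circ> reflection x y = (g \<circ> transpose x y) \<circ> transpose (- x) (- y)"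
      by (simp add: reflection_def comp_assoc)
    also have "\<dots> = transpose (g x) (g y) \<circ> (g \<circ> transpose (- x) (- y))"
      by (simp add: ** comp_assoc)
    also have "\<dots> = reflection (g x) (g y) \<circ> g"
      using False * by (simp add: ** reflection_def comp_assoc assms(2))
    finally show ?thesis .
  qed
qed

text \<open>A simple reflection changes the sign of only one pair of opposite roots. In terms of positions,
  \<open>s\<^sub>k\<close> reverses only its own neighbours and the opposite pair.\<close>

lemma sgen_reverses_imp_reflection:
  assumes "x < y" "x \<noteq> 0" "y \<noteq> 0" "sgen k y < sgen k x"
  shows "reflection x y = sgen k"
proof -
  have "(x = lower_pos k \<and> y = int k + 1) \<or> (x = - (int k + 1) \<and> y = - lower_pos k)"
    using assms by (cases "k = 0") (auto simp: sgen_def lower_pos_def transpose_def split: if_splits)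
  then show ?thesis
    using assms reflection_uminus[of "lower_pos k" "int k + 1"]
    by (auto simp: sgen_reflection simp del: minus_add_distrib)
qed

text \<open>The strong exchange property. Read the word from the right and follow the two positions:
  they start in increasing order and end in decreasing order, so some letter reverses
  them. At that letter the reflection, carried along by conjugation, is the letter itself, and the two
  cancel.\<close>

lemma exchange:
  assumes "x < y" "x \<noteq> 0" "y \<noteq> 0" "word_prod us y < word_prod us x"
  shows "\<exists>vs. set vs \<subseteq> set us \<and> length us = Suc (length vs) \<and>
              word_prod vs = word_prod us \<circ> reflection x y"
  using assms
proof (induction us arbitrary: x y rule: rev_induct)
  case Nil
  then show ?case by (simp add: word_prod_Nil)
next
  case (snoc k us)
  consider "sgen k y < sgen k x" | "sgen k x < sgen k y"
    using snoc.prems(1) inj_sgen[of k] by (metis injD linorder_neqE less_irrefl)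
  then show ?case
  proof cases
    case 1
    then have "word_prod us = word_prod (us @ [k]) \<circ> reflection x y"
      using snoc.prems sgen_reverses_imp_reflection[of x y k] by (simp add: word_prod_snoc)
    then show ?thesis by (intro exI[of _ us]) auto
  next
    case 2
    have "word_prod us (sgen k y) < word_prod us (sgen k x)"
      using snoc.prems(4) by (simp add: word_prod_snoc)
    then obtain vs where vs: "set vs \<subseteq> set us" "length us = Suc (length vs)"
        "word_prod vs = word_prod us \<circ> reflection (sgen k x) (sgen k y)"
      using snoc.IH[OF 2] snoc.prems(2,3) sgen_eq_0_iff by blast
    have "word_prod (vs @ [k]) = word_prod us \<circ> (reflection (sgen k x) (sgen k y) \<circ> sgen k)"
      by (simp add: word_prod_snoc vs(3) comp_assoc)
    also have "\<dots> = word_prod (us @ [k]) \<circ> reflection x y"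
      by (simp add: reflection_conj[OF inj_sgen sgen_odd, symmetric] word_prod_snoc comp_assoc)
    finally show ?thesis using vs(1,2) by (intro exI[of _ "vs @ [k]"]) auto
  qed
qed

lemma exchange_descent:
  assumes "descent (word_prod us) k"
  obtains vs where "set vs \<subseteq> set us" "length us = Suc (length vs)"
    "word_prod vs = word_prod us \<circ> sgen k"
  using exchange[of "lower_pos k" "int k + 1" us] assms
  by (auto simp: descent_def lower_pos_def sgen_reflection split: if_splits)

lemma reduced_ascent:
  assumes "reduced_expression_of n w (us @ k # vs)"
  shows "\<not> descent (word_prod us) k"
proof
  assume "descent (word_prod us) k"
  then obtain us' where us': "set us' \<subseteq> set us" "length us = Suc (length us')"
      "word_prod us' = word_prod us \<circ> sgen k"
    by (rule exchange_descent)
  have "word_prod (us @ k # vs) = word_prod (us @ [k]) \<circ> word_prod vs"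
    by (metis append.assoc append_Cons append_Nil word_prod_append)
  then have "word_prod (us' @ vs) = word_prod (us @ k # vs)"
    by (simp add: word_prod_append[of us'] us'(3) word_prod_snoc)
  then have "expression_of n w (us' @ vs)"
    using assms us'(1) by (auto simp: reduced_expression_of_def expression_of_def)
  then have "length (us @ k # vs) \<le> length (us' @ vs)"
    using assms by (auto simp: reduced_expression_of_def)
  then show False using us'(2) by simp
qed

lemma reduced_snoc:
  assumes "k < n" "descent w k" "reduced_expression_of n (w \<circ> sgen k) us"
  shows "reduced_expression_of n w (us @ [k])"
  unfolding reduced_expression_of_def
proof (intro conjI allI impI)
  have "word_prod us \<circ> sgen k = w"
    using assms(3) by (simp add: reduced_expression_of_def expression_of_def)
  then show "expression_of n w (us @ [k])"
    using assms by (auto simp: reduced_expression_of_def expression_of_def word_prod_snoc)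
next
  fix vs assume vs: "expression_of n w vs"
  then have "descent (word_prod vs) k" using assms(2) by (simp add: expression_of_def)
  then obtain vs' where vs': "set vs' \<subseteq> set vs" "length vs = Suc (length vs')"
      "word_prod vs' = word_prod vs \<circ> sgen k"
    by (rule exchange_descent)
  then have "expression_of n (w \<circ> sgen k) vs'"
    using vs by (auto simp: expression_of_def)
  then show "length (us @ [k]) \<le> length vs"
    using assms(3) vs'(2) by (auto simp: reduced_expression_of_def)
qed

section \<open>Induction along descents\<close>

text \<open>Removing a descent brings a signed permutation closer to the identity. The squared distance
  measures this: two values in the wrong order fit their positions better once they are exchanged,
  and all other positions keep their values.\<close>

lemma sq_dist_descent:
  assumes w: "w \<in> WB n" and k: "k < n" and d: "descent w k"
  shows "(\<Sum>x\<in>pm_set n. (x - (w \<circ> sgen k) x)\<^sup>2) < (\<Sum>x\<in>pm_set n. (x - w x)\<^sup>2)"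
proof -
  let ?A = "{int k + 1, lower_pos k, - (int k + 1), - lower_pos k}"
  have "sgen k permutes pm_set n" using sgen_in_WB[OF k] by (simp add: WB_def)
  then have "(\<Sum>x\<in>pm_set n. (x - (w \<circ> sgen k) x)\<^sup>2) = (\<Sum>x\<in>pm_set n. (sgen k x - w x)\<^sup>2)"
    by (subst sum.permute) (auto simp: o_def)
  also have "\<dots> = (\<Sum>x\<in>pm_set n. (x - w x)\<^sup>2)
               + (\<Sum>x\<in>pm_set n. (sgen k x - w x)\<^sup>2 - (x - w x)\<^sup>2)"
    by (simp add: sum_subtractf)
  also have "(\<Sum>x\<in>pm_set n. (sgen k x - w x)\<^sup>2 - (x - w x)\<^sup>2) =
             (\<Sum>x\<in>?A. (sgen k x - w x)\<^sup>2 - (x - w x)\<^sup>2)"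
    using k by (intro sum.mono_neutral_right finite_pm_set)
      (auto simp: pm_set_def lower_pos_def sgen_def transpose_def split: if_splits)
  also have "\<dots> < 0"
  proof (cases "k = 0")
    case True
    then have "?A = {1, - 1}" by (auto simp: lower_pos_def)
    then have "(\<Sum>x\<in>?A. (sgen k x - w x)\<^sup>2 - (x - w x)\<^sup>2) = 8 * w 1"
      using True by (simp add: sgen_def transpose_def WB_odd[OF w] power2_eq_square
          algebra_simps)
    moreover have "w 1 < 0"
      using d True WB_odd[OF w, of 1] by (simp add: descent_def lower_pos_def)
    ultimately show ?thesis by simp
  next
    case False
    then have "(\<Sum>x\<in>?A. (sgen k x - w x)\<^sup>2 - (x - w x)\<^sup>2) = 4 * (w (int k + 1) - w (int k))"
      using WB_odd[OF w, of "int k"] WB_odd[OF w, of "int k + 1"]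
      by (simp add: lower_pos_def sgen_def transpose_def power2_eq_square algebra_simps)
    then show ?thesis using d False by (simp add: descent_def lower_pos_def)
  qed
  finally show ?thesis by simp
qed

lemma WB_descent_induct [consumes 1, case_names step]:
  assumes "w \<in> WB n"
    and "\<And>w. w \<in> WB n \<Longrightarrow> (\<And>k. k < n \<Longrightarrow> descent w k \<Longrightarrow> P (w \<circ> sgen k)) \<Longrightarrow> P w"
  shows "P w"
  using assms(1)
proof (induction "nat (\<Sum>x\<in>pm_set n. (x - w x)\<^sup>2)" arbitrary: w rule: less_induct)
  case less
  show ?case
  proof (rule assms(2)[OF less.prems])
    fix k assume k: "k < n" "descent w k"
    have "0 \<le> (\<Sum>x\<in>pm_set n. (x - (w \<circ> sgen k) x)\<^sup>2)" by (intro sum_nonneg) simp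
    then show "P (w \<circ> sgen k)"
      using sq_dist_descent[OF less.prems k] k
      by (intro less.hyps WB_comp less.prems sgen_in_WB) auto
  qed
qed

text \<open>Without descents the window is increasing and positive with \<open>n\<close> entries in
  \<open>1, \<dots>, n\<close>, so counting from the left end shows that entry \<open>i\<close> is at least \<open>i\<close>, and counting from the
  right end that it is at most \<open>i\<close>.\<close>

lemma no_descent_imp_id:
  assumes w: "w \<in> WB n" and nd: "\<And>k. k < n \<Longrightarrow> \<not> descent w k"
  shows "w = id"
proof -
  have inc: "w (int i) < w (int i + 1)" if "0 < i" "i < n" for i
    using nd[of i] that WB_eq_iff[OF w, of "int i" "int i + 1"]
    by (simp add: descent_def lower_pos_def)
  have lower: "int i \<le> w (int i)" if "0 < i" "i \<le> n" for i
    using that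
  proof (induction i)
    case (Suc i)
    show ?case
    proof (cases "i = 0")
      case True
      then show ?thesis
        using nd[of 0] Suc.prems WB_odd[OF w, of 1] WB_eq_0_iff[OF w, of 1]
        by (simp add: descent_def lower_pos_def)
    next
      case False
      then show ?thesis using Suc inc[of i] by (simp add: add.commute)
    qed
  qed simp
  have upper: "d < n \<Longrightarrow> w (int (n - d)) \<le> int (n - d)" for d
  proof (induction d)
    case 0
    then show ?case using WB_abs_le[OF w, of "int n"] by simp
  next
    case (Suc d)
    then have "int (n - d) = int (n - Suc d) + 1" by simp
    then show ?case using Suc inc[of "n - Suc d"] by simp
  qed
  have pos: "w (int i) = int i" if "0 < i" "i \<le> n" for i
    using lower[OF that] upper[of "n - i"] that by simp
  have "w x = x" for x
  proof (cases "x \<in> pm_set n")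
    case True
    then have "w \<bar>x\<bar> = \<bar>x\<bar>" using pos[of "nat \<bar>x\<bar>"] by (auto simp: pm_set_def)
    then show ?thesis using WB_odd[OF w, of x] by (auto simp: abs_if split: if_splits)
  next
    case False
    then show ?thesis using w by (auto simp: WB_def permutes_not_in)
  qed
  then show ?thesis by (simp add: fun_eq_iff)
qed

lemma reduced_expression_exists:
  assumes "w \<in> WB n"
  shows "\<exists>us. reduced_expression_of n w us"
  using assms
proof (induction rule: WB_descent_induct)
  case (step w)
  show ?case
  proof (cases "\<exists>k<n. descent w k")
    case True
    then show ?thesis using step.IH reduced_snoc by blast
  next
    case False
    then have "w = id" using no_descent_imp_id step.hyps by blast
    then have "reduced_expression_of n w []"
      by (simp add: reduced_expression_of_def expression_of_def word_prod_Nil)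
    then show ?thesis ..
  qed
qed

section \<open>Negative inversions\<close>

definition negative_inversion :: "nat \<Rightarrow> (int \<Rightarrow> int) \<Rightarrow> int \<Rightarrow> int \<Rightarrow> bool" where
  "negative_inversion n w x y \<longleftrightarrow> 0 < x \<and> x < y \<and> y \<le> int n \<and> w y < w x \<and> w x < 0"

text \<open>The two excluded situations are the only ones in which \<open>s\<^sub>k\<close> spoils the pair of positions: it
  reverses the pair, or it negates its first position.\<close>

lemma negative_inversion_comp_sgen:
  assumes "negative_inversion n w x y" "k < n"
    and "k = 0 \<Longrightarrow> x \<noteq> 1" and "\<not> (x = int k \<and> y = int k + 1)"
  shows "negative_inversion n (w \<circ> sgen k) (sgen k x) (sgen k y)"
proof -
  have "0 < sgen k x \<and> sgen k x < sgen k y \<and> sgen k y \<le> int n"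
    using assms by (cases "k = 0")
      (auto simp: negative_inversion_def sgen_def transpose_def split: if_splits)
  then show ?thesis using assms(1) by (simp add: negative_inversion_def)
qed

lemma negative_inversion_ascent:
  assumes "w \<in> WB n" "negative_inversion n w x y" "k < n" "\<not> descent w k"
  shows "negative_inversion n (w \<circ> sgen k) (sgen k x) (sgen k y)"
proof (rule negative_inversion_comp_sgen[OF assms(2,3)])
  show "x \<noteq> 1" if "k = 0"
    using assms that WB_odd[OF assms(1), of 1]
    by (auto simp: negative_inversion_def descent_def lower_pos_def)
  show "\<not> (x = int k \<and> y = int k + 1)"
    using assms by (auto simp: negative_inversion_def descent_def lower_pos_def split: if_splits)
qed

lemma negative_inversion_reduced_append:
  assumes "reduced_expression_of n w (us @ vs)" "negative_inversion n (word_prod us) x y"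
  shows "\<exists>x y. negative_inversion n w x y"
  using assms
proof (induction vs arbitrary: us x y)
  case Nil
  then show ?case by (auto simp: reduced_expression_of_def expression_of_def)
next
  case (Cons k vs)
  have "set us \<subseteq> {..<n}" "k < n"
    using Cons.prems(1) by (auto simp: reduced_expression_of_def expression_of_def)
  then have "negative_inversion n (word_prod (us @ [k])) (sgen k x) (sgen k y)"
    using negative_inversion_ascent[OF word_prod_in_WB Cons.prems(2)]
      reduced_ascent[OF Cons.prems(1)] by (simp add: word_prod_snoc)
  then show ?case using Cons.IH[of "us @ [k]"] Cons.prems(1) by simp
qed

lemma reduced_0101_imp_negative_inversion:
  assumes red: "reduced_expression_of n w (us @ [0, 1, 0, 1] @ vs)"
  shows "\<exists>x y. negative_inversion n w x y"
proof -
  let ?u = "word_prod us"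
  have us: "set us \<subseteq> {..<n}" and n: "1 < n"
    using red by (auto simp: reduced_expression_of_def expression_of_def)
  note W = word_prod_in_WB[OF us]
  note odd = WB_odd[OF W, of 1] WB_odd[OF W, of 2]
  have s: "sgen 0 1 = - 1" "sgen 0 (- 1) = 1" "sgen 0 2 = 2" "sgen 0 (- 2) = - 2"
    "sgen (Suc 0) 1 = 2" "sgen (Suc 0) 2 = 1" "sgen (Suc 0) (- 1) = - 2" "sgen (Suc 0) (- 2) = - 1"
    by (auto simp: sgen_def transpose_def)
  have prods: "word_prod (us @ [0, Suc 0]) = ?u \<circ> sgen 0 \<circ> sgen (Suc 0)"
    "word_prod (us @ [0, Suc 0, 0]) = ?u \<circ> sgen 0 \<circ> sgen (Suc 0) \<circ> sgen 0"
    "word_prod (us @ [0, Suc 0, 0, Suc 0]) = ?u \<circ> sgen 0 \<circ> sgen (Suc 0) \<circ> sgen 0 \<circ> sgen (Suc 0)"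
    by (simp_all add: word_prod_append) (simp_all add: word_prod_def comp_assoc)
  have "\<not> descent (word_prod (us @ [0, 1])) 0"
    using reduced_ascent[of n w "us @ [0, 1]" 0 "1 # vs"] red by simp
  then have "0 \<le> ?u 2"
    using odd by (simp add: descent_def lower_pos_def prods s)
  have "\<not> descent ?u 0"
    using reduced_ascent[of n w us 0 "[1, 0, 1] @ vs"] red by simp
  then have "0 \<le> ?u 1"
    using odd by (simp add: descent_def lower_pos_def)
  then have "0 < ?u 1" using WB_eq_0_iff[OF W, of 1] by simp
  have "\<not> descent (word_prod (us @ [0, 1, 0])) 1"
    using reduced_ascent[of n w "us @ [0, 1, 0]" 1 vs] red by simp
  then have "?u 1 \<le> ?u 2"
    using odd by (simp add: descent_def lower_pos_def prods s)
  then have "?u 1 < ?u 2" using WB_eq_iff[OF W, of 1 2] by simp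
  then have "negative_inversion n (word_prod (us @ [0, 1, 0, 1])) 1 2"
    using \<open>0 < ?u 1\<close> odd n by (simp add: negative_inversion_def prods s)
  then show ?thesis using negative_inversion_reduced_append[of n w "us @ [0, 1, 0, 1]" vs] red by simp
qed

text \<open>Without descents before position \<open>x\<close> the entries up to \<open>x\<close> would start positive and
  increase, whereas \<open>w x < 0\<close>. A descent at \<open>k < x\<close> can be removed: for \<open>k = 0\<close> only
  the first entry changes sign, which lies before the pair, and for \<open>k > 0\<close> the two entries of
  the pair cannot be the neighbours exchanged, since \<open>y > k + 1\<close>.\<close>

lemma negative_inversion_reducible_first:
  assumes w: "w \<in> WB n" and inv: "negative_inversion n w x y" and x: "x \<noteq> 1"
  shows "\<exists>k<n. descent w k \<and> (\<exists>x y. negative_inversion n (w \<circ> sgen k) x y)"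
proof -
  have x2: "2 \<le> x" and wx: "w x < 0" and xy: "x < y" "y \<le> int n"
    using inv x by (auto simp: negative_inversion_def)
  have "\<exists>k. int k < x \<and> descent w k"
  proof (rule ccontr)
    assume "\<nexists>k. int k < x \<and> descent w k"
    then have nd: "\<not> descent w k" if "int k < x" for k using that by blast
    have "0 \<le> w (int i + 1)" if "int i < x" for i
      using that
    proof (induction i)
      case 0
      then show ?case
        using nd[of 0] x2 WB_odd[OF w, of 1] by (simp add: descent_def lower_pos_def)
    next
      case (Suc i)
      then show ?case using nd[of "Suc i"] by (simp add: descent_def lower_pos_def add.commute)
    qed
    from this[of "nat (x - 1)"] show False using x2 wx by simp
  qed
  then obtain k where k: "int k < x" "descent w k" by blast
  have "k < n" using k xy by simp
  moreover have "negative_inversion n (w \<circ> sgen k) (sgen k x) (sgen k y)"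
    using k x by (intro negative_inversion_comp_sgen[OF inv \<open>k < n\<close>]) auto
  ultimately show ?thesis using k by blast
qed

text \<open>A leftmost partner \<open>y\<close> of position \<open>1\<close> is preceded by a larger entry, since a smaller
  one would be a partner further to the left.\<close>

lemma negative_inversion_reducible_second:
  assumes inv: "negative_inversion n w 1 y" and not2: "\<not> negative_inversion n w 1 2"
    and w: "w \<in> WB n"
  shows "\<exists>k<n. descent w k \<and> (\<exists>x y. negative_inversion n (w \<circ> sgen k) x y)"
proof -
  let ?P = "\<lambda>j. negative_inversion n w 1 (int j)"
  define j where "j = (LEAST j. ?P j)"
  have "?P (nat y)" using inv by (simp add: negative_inversion_def)
  then have j: "?P j" unfolding j_def by (rule LeastI)
  have "j \<noteq> 2" using j not2 by auto
  then have j3: "3 \<le> j" "j \<le> n" using j by (auto simp: negative_inversion_def)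
  have "\<not> ?P (j - 1)" unfolding j_def by (rule not_less_Least) (use j3 j_def in simp)
  then have "w (int j) \<le> w (int (j - 1))"
    using j j3 by (auto simp: negative_inversion_def)
  then have d: "descent w (j - 1)"
    using j3 WB_eq_iff[OF w, of "int j" "int j - 1"]
    by (simp add: descent_def lower_pos_def of_nat_diff)
  have "negative_inversion n (w \<circ> sgen (j - 1)) (sgen (j - 1) 1) (sgen (j - 1) (int j))"
    using j3 by (intro negative_inversion_comp_sgen[OF j]) auto
  moreover have "j - 1 < n" using j3 by simp
  ultimately show ?thesis using d by blast
qed

lemma negative_inversion_12_imp_reduced_0101:
  assumes w: "w \<in> WB n" and inv: "negative_inversion n w 1 2"
  shows "\<exists>us. reduced_expression_of n w (us @ [0, 1, 0, 1])"
proof -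
  have n: "1 < n" and neg: "w 2 < w 1" "w 1 < 0"
    using inv by (auto simp: negative_inversion_def)
  note odd = WB_odd[OF w, of 1] WB_odd[OF w, of 2]
  define w1 where "w1 = w \<circ> sgen 1"
  define w2 where "w2 = w1 \<circ> sgen 0"
  define w3 where "w3 = w2 \<circ> sgen 1"
  define w4 where "w4 = w3 \<circ> sgen 0"
  have s: "sgen 0 1 = - 1" "sgen 0 (- 1) = 1" "sgen 0 2 = 2" "sgen 0 (- 2) = - 2"
    "sgen (Suc 0) 1 = 2" "sgen (Suc 0) 2 = 1" "sgen (Suc 0) (- 1) = - 2" "sgen (Suc 0) (- 2) = - 1"
    by (auto simp: sgen_def transpose_def)
  have d: "descent w 1" "descent w1 0" "descent w2 1" "descent w3 0"
    using neg odd by (simp_all add: descent_def lower_pos_def w1_def w2_def w3_def s)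
  have "w4 \<in> WB n"
    unfolding w4_def w3_def w2_def w1_def using n w by (intro WB_comp sgen_in_WB) auto
  then obtain us where "reduced_expression_of n w4 us" using reduced_expression_exists by blast
  then have "reduced_expression_of n w3 (us @ [0])"
    using d(4) n unfolding w4_def by (intro reduced_snoc) auto
  then have "reduced_expression_of n w2 (us @ [0] @ [1])"
    using d(3) n reduced_snoc[of 1 n w2 "us @ [0]"] unfolding w3_def by simp
  then have "reduced_expression_of n w1 (us @ [0, 1] @ [0])"
    using d(2) n reduced_snoc[of 0 n w1 "us @ [0, 1]"] unfolding w2_def by simp
  then have "reduced_expression_of n w (us @ [0, 1, 0] @ [1])"
    using d(1) n reduced_snoc[of 1 n w "us @ [0, 1, 0]"] unfolding w1_def by simp
  then show ?thesis by auto
qed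

lemma negative_inversion_imp_reduced_0101:
  assumes "w \<in> WB n" "negative_inversion n w x y"
  shows "\<exists>us vs. reduced_expression_of n w (us @ [0, 1, 0, 1] @ vs)"
  using assms
proof (induction arbitrary: x y rule: WB_descent_induct)
  case (step w)
  show ?case
  proof (cases "negative_inversion n w 1 2")
    case True
    then show ?thesis
      using negative_inversion_12_imp_reduced_0101[OF step.hyps] by (metis append_Nil2)
  next
    case False
    then obtain k x' y' where k: "k < n" "descent w k"
        and "negative_inversion n (w \<circ> sgen k) x' y'"
      using negative_inversion_reducible_first[OF step.hyps step.prems]
        negative_inversion_reducible_second[of n w y] step by (cases "x = 1") blast+
    then obtain us vs where "reduced_expression_of n (w \<circ> sgen k) (us @ [0, 1, 0, 1] @ vs)"
      using step.IH by blast
    then have "reduced_expression_of n w (us @ [0, 1, 0, 1] @ (vs @ [k]))"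
      using reduced_snoc[OF k] by fastforce
    then show ?thesis by blast
  qed
qed

section \<open>The characterization\<close>

lemma reduced_braid:
  assumes "reduced_expression_of n w (us @ [1, 0, 1, 0] @ vs)"
  shows "reduced_expression_of n w (us @ [0, 1, 0, 1] @ vs)"
proof -
  have "word_prod (us @ [0, 1, 0, 1] @ vs) = word_prod (us @ [1, 0, 1, 0] @ vs)"
    by (simp only: word_prod_append braid_relation)
  then show ?thesis using assms by (auto simp: reduced_expression_of_def expression_of_def)
qed

lemma B4_iff_no_negative_inversion:
  assumes "w \<in> WB n"
  shows "w \<in> B4 n \<longleftrightarrow> \<not> (\<exists>x y. negative_inversion n w x y)"
proof
  assume "w \<in> B4 n"
  then show "\<not> (\<exists>x y. negative_inversion n w x y)"
    using negative_inversion_imp_reduced_0101[OF assms] by (fastforce simp: B4_def sublist_def)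
next
  assume "\<not> (\<exists>x y. negative_inversion n w x y)"
  then have "\<not> reduced_expression_of n w (us @ [0, 1, 0, 1] @ vs)" for us vs
    using reduced_0101_imp_negative_inversion by blast
  then show "w \<in> B4 n"
    using assms reduced_braid unfolding B4_def sublist_def by blast
qed

theorem lemma5p2:
  fixes n :: nat and w :: "int \<Rightarrow> int" and a :: "nat \<Rightarrow> int"
  assumes "n \<ge> 2"
    and "w \<in> WB n"
    and "\<And>i. 1 \<le> i \<Longrightarrow> i \<le> n \<Longrightarrow> w (int i) = a i"
  shows "w \<in> B4 n \<longleftrightarrow>
    \<not> (\<exists>i j. 1 \<le> i \<and> i < j \<and> j \<le> n \<and> a i > a j \<and> a i < 0 \<and> a j < 0)"
proof -
  have "(\<exists>x y. negative_inversion n w x y) \<longleftrightarrow>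
    (\<exists>i j. 1 \<le> i \<and> i < j \<and> j \<le> n \<and> a i > a j \<and> a i < 0 \<and> a j < 0)"
  proof
    assume "\<exists>x y. negative_inversion n w x y"
    then obtain x y where inv: "negative_inversion n w x y" by blast
    then have "a (nat x) = w x" "a (nat y) = w y"
      using assms(3)[of "nat x"] assms(3)[of "nat y"] by (auto simp: negative_inversion_def)
    then show "\<exists>i j. 1 \<le> i \<and> i < j \<and> j \<le> n \<and> a i > a j \<and> a i < 0 \<and> a j < 0"
      using inv by (intro exI[of _ "nat x"] exI[of _ "nat y"]) (auto simp: negative_inversion_def)
  next
    assume "\<exists>i j. 1 \<le> i \<and> i < j \<and> j \<le> n \<and> a i > a j \<and> a i < 0 \<and> a j < 0"
    then obtain i j where "1 \<le> i" "i < j" "j \<le> n" "a i > a j" "a i < 0" by blast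
    then have "negative_inversion n w (int i) (int j)"
      using assms(3)[of i] assms(3)[of j] by (simp add: negative_inversion_def)
    then show "\<exists>x y. negative_inversion n w x y" by blast
  qed
  then show ?thesis using B4_iff_no_negative_inversion[OF assms(2)] by simp
qed

end
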